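(* Let $G=(V,E)$ be a finite simple undirected graph, $x,y\in V$ distinct, and let $G^{x,y}$ be obtained from $G$ by identifying $x$ and $y$. Then \[\tfrac14\operatorname{nlcw}(G)\le\operatorname{nlcw}(G^{x,y})\le 2\operatorname{nlcw}(G)\quad\text{and}\quad \tfrac14\operatorname{cw}(G)\le\operatorname{cw}(G^{x,y})\le 2\operatorname{cw}(G).\]
   Context: Vertex identification: $G^{x,y}$ has vertex set $(V\setminus\{x,y\})\cup\{z\}$ for a new vertex $z$, and edge set consisting of all edges of $G$ not incident to $x$ or $y$, together with $\{u,z\}$ for every $u\notin\{x,y\}$ such that $\{u,x\}\in E$ or $\{u,y\}\in E$. Clique-width: for a positive integer $k$, $\mathrm{CW}_k$ is the smallest class of graphs whose vertices carry labels from $\{1,\dots,k\}$ that contains every single-vertex graph with any label and is closed under: disjoint union; relabeling $\rho_{a\to b}$ for $a\neq b$; and $\eta_{a,b}$ for $a\neq b$ (add all edges between vertices labeled $a$ and vertices labeled $b$). $\operatorname{cw}(G)$ is the least $k$ such that some labeling of $G$ lies in $\mathrm{CW}_k$. NLC-width: $\mathrm{NLC}_k$ is the smallest class of labeled graphs (labels in $\{1,\dots,k\}$) containing every single-vertex graph with any label and closed under: $G\times_S J$ for $S\subseteq\{1,\dots,k\}^2$ (disjoint union of vertex-disjoint $G$ and $J$ plus all edges $\{u,v\}$, $u\in V_G$, $v\in V_J$, $(\mathrm{lab}(u),\mathrm{lab}(v))\in S$); and $\circ_R$ for $R:\{1,\dots,k\}\to\{1,\dots,k\}$. $\operatorname{nlcw}(G)$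 is the least $k$ such that some labeling of $G$ lies in $\mathrm{NLC}_k$. *)

theory Defs
  imports Complex_Main
begin

type_synonym 'a graph = "'a set \<times> 'a set set"

definition finite_simple_graph :: "'a graph \<Rightarrow> bool" where
  "finite_simple_graph G \<longleftrightarrow>
     finite (fst G) \<and> snd G \<subseteq> {{u, v} | u v. u \<in> fst G \<and> v \<in> fst G \<and> u \<noteq> v}"

text \<open>The new vertex is \<^const>\<open>None\<close>; the remaining vertices are embedded by \<^const>\<open>Some\<close>.\<close>

definition identify :: "'a graph \<Rightarrow> 'a \<Rightarrow> 'a \<Rightarrow> 'a option graph" where
  "identify G x y =
     (insert None (Some ` (fst G - {x, y})),
      {Some ` e | e. e \<in> snd G \<and> x \<notin> e \<and> y \<notin> e} \<union>
      {{Some u, None} | u. u \<notin> {x, y} \<and> ({u, x} \<in> snd G \<or> {u, y} \<in> snd G)})"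

text \<open>In a labeled graph \<open>(V, E, l)\<close> only the values of \<open>l\<close> on \<open>V\<close> are meaningful.\<close>

type_synonym 'a lgraph = "'a set \<times> 'a set set \<times> ('a \<Rightarrow> nat)"

inductive_set CW :: "nat \<Rightarrow> 'a lgraph set" for k :: nat where
  single: "a \<in> {1..k} \<Longrightarrow> ({v}, {}, \<lambda>_. a) \<in> CW k"
| union: "(V\<^sub>1, E\<^sub>1, l\<^sub>1) \<in> CW k \<Longrightarrow> (V\<^sub>2, E\<^sub>2, l\<^sub>2) \<in> CW k \<Longrightarrow> V\<^sub>1 \<inter> V\<^sub>2 = {} \<Longrightarrow>
    (V\<^sub>1 \<union> V\<^sub>2, E\<^sub>1 \<union> E\<^sub>2, \<lambda>v. if v \<in> V\<^sub>1 then l\<^sub>1 v else l\<^sub>2 v) \<in> CW k"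
| relabel: "(V, E, l) \<in> CW k \<Longrightarrow> a \<in> {1..k} \<Longrightarrow> b \<in> {1..k} \<Longrightarrow> a \<noteq> b \<Longrightarrow>
    (V, E, \<lambda>v. if l v = a then b else l v) \<in> CW k"
| join: "(V, E, l) \<in> CW k \<Longrightarrow> a \<in> {1..k} \<Longrightarrow> b \<in> {1..k} \<Longrightarrow> a \<noteq> b \<Longrightarrow>
    (V, E \<union> {{u, v} | u v. u \<in> V \<and> v \<in> V \<and> l u = a \<and> l v = b}, l) \<in> CW k"

definition cw :: "'a graph \<Rightarrow> nat" where
  "cw G = (LEAST k. 1 \<le> k \<and> (\<exists>l. (fst G, snd G, l) \<in> CW k))"

inductive_set NLC :: "nat \<Rightarrow> 'a lgraph set" for k :: nat where
  single: "a \<in> {1..k} \<Longrightarrow> ({v}, {}, \<lambda>_. a) \<in> NLC k"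
| union: "(V\<^sub>1, E\<^sub>1, l\<^sub>1) \<in> NLC k \<Longrightarrow> (V\<^sub>2, E\<^sub>2, l\<^sub>2) \<in> NLC k \<Longrightarrow> V\<^sub>1 \<inter> V\<^sub>2 = {} \<Longrightarrow>
    S \<subseteq> {1..k} \<times> {1..k} \<Longrightarrow>
    (V\<^sub>1 \<union> V\<^sub>2,
     E\<^sub>1 \<union> E\<^sub>2 \<union> {{u, v} | u v. u \<in> V\<^sub>1 \<and> v \<in> V\<^sub>2 \<and> (l\<^sub>1 u, l\<^sub>2 v) \<in> S},
     \<lambda>v. if v \<in> V\<^sub>1 then l\<^sub>1 v else l\<^sub>2 v) \<in> NLC k"
| relabel: "(V, E, l) \<in> NLC k \<Longrightarrow> R ` {1..k} \<subseteq> {1..k} \<Longrightarrow> (V, E, R \<circ> l) \<in> NLC k"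

definition nlcw :: "'a graph \<Rightarrow> nat" where
  "nlcw G = (LEAST k. 1 \<le> k \<and> (\<exists>l. (fst G, snd G, l) \<in> NLC k))"

end

theory Submission
  imports Defs
begin

text \<open>Both \<open>G\<close> and \<open>G\<^sup>x\<^sup>y\<close> arise from \<open>K = G - {x, y}\<close> by adding two vertices and one vertex,
  respectively. Both widths are monotone under induced subgraphs, so it suffices that adding one
  vertex \<open>v\<close> at most doubles the width. For that, split every label into two copies, according to
  adjacency with \<open>v\<close>. For NLC-width a final union with \<open>v\<close> adds the missing edges. For clique-width
  \<open>v\<close> needs a label of its own: if \<open>k \<ge> 2\<close>, one is freed by first merging each of the two halves of
  the labels to a single label; if \<open>k = 1\<close>, there are no edges besides those at \<open>v\<close>, and the result
  is a star with isolated vertices.\<close>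

section \<open>Adding a vertex to a simple graph\<close>

lemma finite_simple_graph_edge:
  assumes "finite_simple_graph (V, E)" "e \<in> E"
  obtains a b where "e = {a, b}" "a \<in> V" "b \<in> V" "a \<noteq> b"
proof -
  have "e \<in> {{u, v} | u v. u \<in> V \<and> v \<in> V \<and> u \<noteq> v}"
    using assms unfolding finite_simple_graph_def fst_conv snd_conv by (meson subsetD)
  then show thesis using that by blast
qed

lemma finite_simple_graphI:
  assumes "finite V" "\<And>e. e \<in> E \<Longrightarrow> \<exists>a b. e = {a, b} \<and> a \<in> V \<and> b \<in> V \<and> a \<noteq> b"
  shows "finite_simple_graph (V, E)"
  unfolding finite_simple_graph_def fst_conv snd_conv using assms by blast

lemma finite_simple_graph_induced:
  assumes "finite_simple_graph (V, E)" "U \<subseteq> V"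
  shows "finite_simple_graph (U, {e \<in> E. e \<subseteq> U})"
proof (rule finite_simple_graphI)
  show "finite U"
    using assms finite_subset unfolding finite_simple_graph_def by auto
  fix e assume e: "e \<in> {e \<in> E. e \<subseteq> U}"
  then obtain a b where "e = {a, b}" "a \<noteq> b"
    using assms(1) finite_simple_graph_edge by (metis (lifting) mem_Collect_eq)
  with e show "\<exists>a b. e = {a, b} \<and> a \<in> U \<and> b \<in> U \<and> a \<noteq> b" by blast
qed

text \<open>An edge that is not contained in \<open>V\<close> must contain \<open>v\<close>, and
  since it has two distinct ends its other end lies in \<open>V\<close>. This separates the edges of
  the smaller graph from those that come with the new vertex.\<close>

lemma edges_insert_vertex:
  assumes "finite_simple_graph (insert v V, E)" "v \<notin> V"
  shows "E = {e \<in> E. e \<subseteq> V} \<union> {{u, v} | u. u \<in> V \<and> {u, v} \<in> E}"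
proof -
  have "e \<subseteq> V \<or> (\<exists>u. e = {u, v} \<and> u \<in> V)" if "e \<in> E" for e
    using assms(1) that
  proof (rule finite_simple_graph_edge)
    fix a b assume "e = {a, b}" "a \<in> insert v V" "b \<in> insert v V" "a \<noteq> b"
    then show ?thesis by (metis empty_subsetI insert_commute insert_iff insert_subset)
  qed
  then show ?thesis by blast
qed

lemma doubleton_Collect_cong:
  "(\<And>u v. P u v \<longleftrightarrow> Q u v) \<Longrightarrow> {{u, v} | u v. P u v} = {{u, v} | u v. Q u v}"
  by simp

text \<open>Serves the embedding lemmas of both widths: the edges created by one operation on
  renamed vertices are the renamed edges created by that operation on the original ones.\<close>

lemma doubleton_Collect_image:
  "{{u, v} | u v. u \<in> f ` A \<and> v \<in> f ` B \<and> P u v} =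
   (`) f ` {{u, v} | u v. u \<in> A \<and> v \<in> B \<and> P (f u) (f v)}" (is "?L = ?R")
proof
  show "?L \<subseteq> ?R"
  proof
    fix e assume "e \<in> ?L"
    then obtain u v where "e = f ` {u, v}" "u \<in> A" "v \<in> B" "P (f u) (f v)" by auto
    then show "e \<in> ?R" by blast
  qed
  show "?R \<subseteq> ?L"
  proof
    fix e assume "e \<in> ?R"
    then obtain u v where "e = {f u, f v}" "u \<in> A" "v \<in> B" "P (f u) (f v)" by auto
    then show "e \<in> ?L" by blast
  qed
qed

section \<open>NLC-width\<close>

text \<open>Unlike \<^const>\<open>NLC\<close>, this predicate is invariant under changing labels outside \<open>V\<close>, and it
  admits the empty graph, so that induced subgraphs need no case distinction.\<close>

definition NLC_on :: "nat \<Rightarrow> 'a set \<Rightarrow> 'a set set \<Rightarrow> ('a \<Rightarrow> nat) \<Rightarrow> bool" where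
  "NLC_on k V E l \<longleftrightarrow> V = {} \<and> E = {} \<or> (\<exists>l'. (V, E, l') \<in> NLC k \<and> (\<forall>v\<in>V. l' v = l v))"

text \<open>Two of these invariants carry later arguments. Edges staying inside \<open>V\<close>
  make restriction to \<open>U\<close> and to \<open>U \<inter> V\<close> agree, and labels staying
  in \<open>{1..k}\<close> make \<open>c\<close> and \<open>c + k\<close> distinguishable as two
  copies of a label.\<close>

lemma NLC_wf:
  "(V, E, l) \<in> NLC k \<Longrightarrow> V \<noteq> {} \<and> {} \<notin> E \<and> (\<forall>e\<in>E. e \<subseteq> V) \<and> l ` V \<subseteq> {1..k}"
proof (induction V E l rule: NLC.induct)
  case (union V\<^sub>1 E\<^sub>1 l\<^sub>1 V\<^sub>2 E\<^sub>2 l\<^sub>2 S)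
  have "(\<lambda>v. if v \<in> V\<^sub>1 then l\<^sub>1 v else l\<^sub>2 v) ` (V\<^sub>1 \<union> V\<^sub>2) \<subseteq> {1..k}"
    using union.IH by (auto simp: image_subset_iff)
  moreover have "V\<^sub>1 \<union> V\<^sub>2 \<noteq> {}" using union.IH by blast
  moreover have "{} \<notin> E\<^sub>1 \<union> E\<^sub>2 \<union> {{u, v} | u v. u \<in> V\<^sub>1 \<and> v \<in> V\<^sub>2 \<and> (l\<^sub>1 u, l\<^sub>2 v) \<in> S}"
    using union.IH by blast
  moreover have "\<forall>e \<in> E\<^sub>1 \<union> E\<^sub>2 \<union> {{u, v} | u v. u \<in> V\<^sub>1 \<and> v \<in> V\<^sub>2 \<and> (l\<^sub>1 u, l\<^sub>2 v) \<in> S}. e \<subseteq> V\<^sub>1 \<union> V\<^sub>2"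
    using union.IH by blast
  ultimately show ?case by blast
qed (simp_all add: image_subset_iff)

lemma NLC_on_cong:
  "NLC_on k V E l \<Longrightarrow> (\<And>v. v \<in> V \<Longrightarrow> l v = l' v) \<Longrightarrow> NLC_on k V E l'"
  unfolding NLC_on_def by metis

lemma NLC_onI: "(V, E, l) \<in> NLC k \<Longrightarrow> (\<And>v. v \<in> V \<Longrightarrow> l v = l' v) \<Longrightarrow> NLC_on k V E l'"
  unfolding NLC_on_def by blast

lemma NLC_onE:
  assumes "NLC_on k V E l" "V \<noteq> {} \<or> E \<noteq> {}"
  obtains l' where "(V, E, l') \<in> NLC k" "\<forall>v\<in>V. l' v = l v"
  using assms unfolding NLC_on_def by blast

lemma NLC_on_empty: "NLC_on k {} {} l"
  unfolding NLC_on_def by blast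

lemma NLC_on_single: "l v \<in> {1..k} \<Longrightarrow> NLC_on k {v} {} l"
  by (rule NLC_onI[OF NLC.single]) auto

lemma NLC_on_union:
  assumes "NLC_on k V\<^sub>1 E\<^sub>1 l" "NLC_on k V\<^sub>2 E\<^sub>2 l" "V\<^sub>1 \<inter> V\<^sub>2 = {}" "S \<subseteq> {1..k} \<times> {1..k}"
  shows "NLC_on k (V\<^sub>1 \<union> V\<^sub>2)
    (E\<^sub>1 \<union> E\<^sub>2 \<union> {{u, v} | u v. u \<in> V\<^sub>1 \<and> v \<in> V\<^sub>2 \<and> (l u, l v) \<in> S}) l"
proof (cases "V\<^sub>1 = {} \<and> E\<^sub>1 = {} \<or> V\<^sub>2 = {} \<and> E\<^sub>2 = {}")
  case True
  then show ?thesis using assms(1,2) by auto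
next
  case False
  then have "V\<^sub>1 \<noteq> {} \<or> E\<^sub>1 \<noteq> {}" "V\<^sub>2 \<noteq> {} \<or> E\<^sub>2 \<noteq> {}" by simp_all
  with assms(1,2) obtain l\<^sub>1 l\<^sub>2 where
    l: "(V\<^sub>1, E\<^sub>1, l\<^sub>1) \<in> NLC k" "\<forall>v\<in>V\<^sub>1. l\<^sub>1 v = l v"
      "(V\<^sub>2, E\<^sub>2, l\<^sub>2) \<in> NLC k" "\<forall>v\<in>V\<^sub>2. l\<^sub>2 v = l v"
    by (elim NLC_onE) blast
  have "{{u, v} | u v. u \<in> V\<^sub>1 \<and> v \<in> V\<^sub>2 \<and> (l u, l v) \<in> S} =
        {{u, v} | u v. u \<in> V\<^sub>1 \<and> v \<in> V\<^sub>2 \<and> (l\<^sub>1 u, l\<^sub>2 v) \<in> S}"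
    using l(2,4) by (intro doubleton_Collect_cong) auto
  with NLC.union[OF l(1,3) assms(3,4)] have "(V\<^sub>1 \<union> V\<^sub>2,
      E\<^sub>1 \<union> E\<^sub>2 \<union> {{u, v} | u v. u \<in> V\<^sub>1 \<and> v \<in> V\<^sub>2 \<and> (l u, l v) \<in> S},
      \<lambda>v. if v \<in> V\<^sub>1 then l\<^sub>1 v else l\<^sub>2 v) \<in> NLC k" by simp
  then show ?thesis by (rule NLC_onI) (use l(2,4) in auto)
qed

lemma NLC_on_relabel:
  assumes "NLC_on k V E l" "R ` {1..k} \<subseteq> {1..k}" "\<And>v. v \<in> V \<Longrightarrow> l' v = R (l v)"
  shows "NLC_on k V E l'"
proof (cases "V = {} \<and> E = {}")
  case False
  then have "V \<noteq> {} \<or> E \<noteq> {}" by simp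
  with assms(1) obtain m where m: "(V, E, m) \<in> NLC k" "\<forall>v\<in>V. m v = l v"
    by (rule NLC_onE)
  show ?thesis
    by (rule NLC_onI[OF NLC.relabel[OF m(1) assms(2)]]) (use m(2) assms(3) in simp)
qed (use NLC_on_empty in blast)

section \<open>Induced subgraphs and injective renaming for NLC-width\<close>

text \<open>Restriction to \<open>U\<close> and renaming by \<open>f\<close> commute with every
  operation, so one induction handles both. In a union each operand is restricted to its share of
  \<open>U\<close>, which may be empty; injectivity of \<open>f\<close> keeps the two images
  disjoint.\<close>

lemma NLC_embed:
  "(V, E, l) \<in> NLC k \<Longrightarrow> U \<subseteq> V \<Longrightarrow> inj_on f U \<Longrightarrow> (\<And>v. v \<in> U \<Longrightarrow> l' (f v) = l v) \<Longrightarrow>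
   NLC_on k (f ` U) ((`) f ` {e \<in> E. e \<subseteq> U}) l'"
proof (induction V E l arbitrary: U l' rule: NLC.induct)
  case (single a v)
  then have "U = {} \<or> U = {v}" by auto
  then show ?case
  proof
    assume "U = {v}"
    then show ?thesis using single NLC_on_single[of l' "f v" k] by auto
  qed (simp add: NLC_on_def)
next
  case (union V\<^sub>1 E\<^sub>1 l\<^sub>1 V\<^sub>2 E\<^sub>2 l\<^sub>2 S)
  let ?X = "{{u, v} | u v. u \<in> V\<^sub>1 \<and> v \<in> V\<^sub>2 \<and> (l\<^sub>1 u, l\<^sub>2 v) \<in> S}"
  let ?U\<^sub>1 = "U \<inter> V\<^sub>1" and ?U\<^sub>2 = "U \<inter> V\<^sub>2"
  have lab: "l' (f v) = l\<^sub>1 v" if "v \<in> ?U\<^sub>1" for v using union.prems(3)[of v] that by auto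
  have lab': "l' (f v) = l\<^sub>2 v" if "v \<in> ?U\<^sub>2" for v
    using union.prems(3)[of v] union.hyps(3) that by auto
  have "NLC_on k (f ` ?U\<^sub>1) ((`) f ` {e \<in> E\<^sub>1. e \<subseteq> ?U\<^sub>1}) l'"
    using union.IH(1)[of ?U\<^sub>1 l'] lab inj_on_subset[OF union.prems(2)] by auto
  moreover have "NLC_on k (f ` ?U\<^sub>2) ((`) f ` {e \<in> E\<^sub>2. e \<subseteq> ?U\<^sub>2}) l'"
    using union.IH(2)[of ?U\<^sub>2 l'] lab' inj_on_subset[OF union.prems(2)] by auto
  moreover have "f ` ?U\<^sub>1 \<inter> f ` ?U\<^sub>2 = {}"
    using union.hyps(3) union.prems(2) by (auto dest: inj_onD)
  ultimately have *: "NLC_on k (f ` ?U\<^sub>1 \<union> f ` ?U\<^sub>2)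
    ((`) f ` {e \<in> E\<^sub>1. e \<subseteq> ?U\<^sub>1} \<union> (`) f ` {e \<in> E\<^sub>2. e \<subseteq> ?U\<^sub>2} \<union>
     {{u, v} | u v. u \<in> f ` ?U\<^sub>1 \<and> v \<in> f ` ?U\<^sub>2 \<and> (l' u, l' v) \<in> S}) l'"
    by (rule NLC_on_union) (rule union.hyps(4))
  have "{{u, v} | u v. u \<in> f ` ?U\<^sub>1 \<and> v \<in> f ` ?U\<^sub>2 \<and> (l' u, l' v) \<in> S} =
      (`) f ` {{u, v} | u v. u \<in> ?U\<^sub>1 \<and> v \<in> ?U\<^sub>2 \<and> (l\<^sub>1 u, l\<^sub>2 v) \<in> S}"
    unfolding doubleton_Collect_image
    by (intro arg_cong[where f = "(`) ((`) f)"] doubleton_Collect_cong) (use lab lab' in auto)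
  also have "{{u, v} | u v. u \<in> ?U\<^sub>1 \<and> v \<in> ?U\<^sub>2 \<and> (l\<^sub>1 u, l\<^sub>2 v) \<in> S} = {e \<in> ?X. e \<subseteq> U}"
    by auto
  finally have X: "{{u, v} | u v. u \<in> f ` ?U\<^sub>1 \<and> v \<in> f ` ?U\<^sub>2 \<and> (l' u, l' v) \<in> S} =
    (`) f ` {e \<in> ?X. e \<subseteq> U}" .
  have "{e \<in> E\<^sub>1. e \<subseteq> ?U\<^sub>1} = {e \<in> E\<^sub>1. e \<subseteq> U}" "{e \<in> E\<^sub>2. e \<subseteq> ?U\<^sub>2} = {e \<in> E\<^sub>2. e \<subseteq> U}"
    using NLC_wf[OF union.hyps(1)] NLC_wf[OF union.hyps(2)] by auto
  moreover have "{e \<in> E\<^sub>1 \<union> E\<^sub>2 \<union> ?X. e \<subseteq> U} =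
      {e \<in> E\<^sub>1. e \<subseteq> U} \<union> {e \<in> E\<^sub>2. e \<subseteq> U} \<union> {e \<in> ?X. e \<subseteq> U}" by blast
  moreover have "f ` U = f ` ?U\<^sub>1 \<union> f ` ?U\<^sub>2" using union.prems(1) by auto
  ultimately show ?case using * unfolding X by (simp only: image_Un)
next
  case (relabel V E l R)
  \<comment> \<open>The given \<open>l'\<close> describes the labels after applying
    \<open>R\<close>, so the induction hypothesis is used with the earlier labels, carried over to
    the image of \<open>f\<close>.\<close>
  have "NLC_on k (f ` U) ((`) f ` {e \<in> E. e \<subseteq> U}) (l \<circ> inv_into U f)"
    using relabel.prems by (intro relabel.IH) auto
  then show ?case
    by (rule NLC_on_relabel[where R = R]) (use relabel in auto)
qed

lemma NLC_on_embed:
  assumes "NLC_on k V E l" "U \<subseteq> V" "inj_on f U"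
  shows "\<exists>l'. NLC_on k (f ` U) ((`) f ` {e \<in> E. e \<subseteq> U}) l'"
proof (cases "V = {} \<and> E = {}")
  case False
  then obtain l' where "(V, E, l') \<in> NLC k" using assms(1) unfolding NLC_on_def by auto
  from NLC_embed[OF this assms(2,3), of "l' \<circ> inv_into U f"] assms(3) show ?thesis by auto
qed (use assms in \<open>auto simp: NLC_on_def\<close>)

section \<open>Adding one vertex for NLC-width\<close>

text \<open>Label \<open>c\<close> gets a second copy \<open>c + k\<close>, reserved for the
  vertices of \<open>N\<close>. Each operation can be made to treat both copies alike, so the same
  edges arise while membership in \<open>N\<close> stays readable from the label.\<close>

lemma NLC_split_labels:
  "(V, E, l) \<in> NLC k \<Longrightarrow> NLC_on (2 * k) V E (\<lambda>v. if v \<in> N then l v + k else l v)"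
proof (induction V E l rule: NLC.induct)
  case (single a v)
  then show ?case by (intro NLC_on_single) auto
next
  case (union V\<^sub>1 E\<^sub>1 l\<^sub>1 V\<^sub>2 E\<^sub>2 l\<^sub>2 S)
  define l where "l = (\<lambda>v. if v \<in> V\<^sub>1 then l\<^sub>1 v else l\<^sub>2 v)"
  define m where "m = (\<lambda>v. if v \<in> N then l v + k else l v)"
  \<comment> \<open>\<open>b\<close> forgets which copy a label belongs to, and \<open>T\<close> is
    the preimage of \<open>S\<close> under \<open>b\<close> in both coordinates. Joining along
    \<open>T\<close> therefore creates the same edges as joining along \<open>S\<close>.\<close>
  define b where "b = (\<lambda>c. if c > k then c - k else c)"
  define T where "T = {(c, d). c \<in> {1..2*k} \<and> d \<in> {1..2*k} \<and> (b c, b d) \<in> S}"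
  have l: "l ` (V\<^sub>1 \<union> V\<^sub>2) \<subseteq> {1..k}"
    using NLC_wf[OF union.hyps(1)] NLC_wf[OF union.hyps(2)] by (auto simp: l_def)
  have "b (m v) = l v \<and> m v \<in> {1..2*k}" if "v \<in> V\<^sub>1 \<union> V\<^sub>2" for v
  proof -
    have "l v \<in> {1..k}" using l that by blast
    then show ?thesis by (auto simp: b_def m_def)
  qed
  moreover have "l v = l\<^sub>2 v" if "v \<in> V\<^sub>2" for v using that union.hyps(3) by (auto simp: l_def)
  moreover have "l u = l\<^sub>1 u" if "u \<in> V\<^sub>1" for u using that by (auto simp: l_def)
  ultimately have iff: "(m u, m v) \<in> T \<longleftrightarrow> (l\<^sub>1 u, l\<^sub>2 v) \<in> S" if "u \<in> V\<^sub>1" "v \<in> V\<^sub>2" for u v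
    using that by (auto simp: T_def)
  have "NLC_on (2*k) V\<^sub>1 E\<^sub>1 m"
    by (rule NLC_on_cong[OF union.IH(1)]) (auto simp: m_def l_def)
  moreover have "NLC_on (2*k) V\<^sub>2 E\<^sub>2 m"
    by (rule NLC_on_cong[OF union.IH(2)]) (use union.hyps(3) in \<open>auto simp: m_def l_def\<close>)
  ultimately have "NLC_on (2*k) (V\<^sub>1 \<union> V\<^sub>2)
      (E\<^sub>1 \<union> E\<^sub>2 \<union> {{u, v} | u v. u \<in> V\<^sub>1 \<and> v \<in> V\<^sub>2 \<and> (m u, m v) \<in> T}) m"
    by (rule NLC_on_union) (use union.hyps(3) in \<open>auto simp: T_def\<close>)
  moreover have "{{u, v} | u v. u \<in> V\<^sub>1 \<and> v \<in> V\<^sub>2 \<and> (m u, m v) \<in> T} =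
      {{u, v} | u v. u \<in> V\<^sub>1 \<and> v \<in> V\<^sub>2 \<and> (l\<^sub>1 u, l\<^sub>2 v) \<in> S}"
    using iff by (intro doubleton_Collect_cong) auto
  ultimately have "NLC_on (2*k) (V\<^sub>1 \<union> V\<^sub>2)
      (E\<^sub>1 \<union> E\<^sub>2 \<union> {{u, v} | u v. u \<in> V\<^sub>1 \<and> v \<in> V\<^sub>2 \<and> (l\<^sub>1 u, l\<^sub>2 v) \<in> S}) m"
    by (simp only:)
  then show ?case unfolding m_def l_def .
next
  case (relabel V E l R)
  show ?case
  proof (rule NLC_on_relabel[OF relabel.IH])
    \<comment> \<open>The map \<open>R\<close> is applied within each copy, so no vertex changes
      copy.\<close>
    let ?R = "\<lambda>c. if c > k then R (c - k) + k else R c"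
    show "?R ` {1..2*k} \<subseteq> {1..2*k}"
    proof
      fix d assume "d \<in> ?R ` {1..2*k}"
      then obtain c where c: "c \<in> {1..2*k}" "d = ?R c" by (elim imageE)
      then have "(if c > k then c - k else c) \<in> {1..k}" by auto
      then have "R (if c > k then c - k else c) \<in> {1..k}" using relabel.hyps(2) by blast
      then show "d \<in> {1..2*k}" using c by (auto split: if_splits)
    qed
    show "(if v \<in> N then (R \<circ> l) v + k else (R \<circ> l) v) =
      ?R (if v \<in> N then l v + k else l v)" if "v \<in> V" for v
    proof -
      have "l v \<in> {1..k}" using NLC_wf[OF relabel.hyps(1)] that by auto
      then show ?thesis by simp
    qed
  qed
qed

text \<open>With the neighbours of \<open>v\<close> as the set \<open>N\<close>, a label above
  \<open>k\<close> means adjacency to \<open>v\<close>. A single union with the one-vertex graph on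
  \<open>v\<close>, along \<open>{k+1..2*k} \<times> {1}\<close>, then supplies exactly the missing
  edges.\<close>

lemma NLC_on_insert_vertex:
  assumes "finite_simple_graph (insert v V, E)" "v \<notin> V" "1 \<le> k" "NLC_on k V {e \<in> E. e \<subseteq> V} l"
  shows "\<exists>l. NLC_on (2 * k) (insert v V) E l"
proof (cases "V = {}")
  case True
  then have "E = {}" using assms(1) unfolding finite_simple_graph_def by auto
  then show ?thesis using True NLC_on_single[of "\<lambda>_. 1" v "2 * k"] assms(3) by auto
next
  case False
  then obtain l' where l': "(V, {e \<in> E. e \<subseteq> V}, l') \<in> NLC k"
    using assms(4) unfolding NLC_on_def by auto
  \<comment> \<open>Label 1 for \<open>v\<close> may also occur in \<open>V\<close>. This is
    harmless, because a union adds edges only between its two operands.\<close>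
  define m where
    "m = (\<lambda>u. if u = v then 1 else if u \<in> {u. {u, v} \<in> E} then l' u + k else l' u)"
  have m1: "m v = 1" by (simp add: m_def)
  have "NLC_on (2*k) V {e \<in> E. e \<subseteq> V} m"
    by (rule NLC_on_cong[OF NLC_split_labels[OF l', of "{u. {u, v} \<in> E}"]])
       (use assms(2) in \<open>auto simp: m_def\<close>)
  moreover have "NLC_on (2*k) {v} {} m"
    by (rule NLC_on_single) (use assms(3) in \<open>auto simp: m_def\<close>)
  ultimately have "NLC_on (2*k) (V \<union> {v}) ({e \<in> E. e \<subseteq> V} \<union> {} \<union>
      {{u, w} | u w. u \<in> V \<and> w \<in> {v} \<and> (m u, m w) \<in> {k+1..2*k} \<times> {1}}) m"
    by (rule NLC_on_union) (use assms(2,3) in auto)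
  moreover have "m u \<in> {k+1..2*k} \<longleftrightarrow> {u, v} \<in> E" if "u \<in> V" for u
  proof -
    have "l' u \<in> {1..k}" "u \<noteq> v" using NLC_wf[OF l'] that assms(2) by auto
    then show ?thesis by (auto simp: m_def)
  qed
  then have "{{u, w} | u w. u \<in> V \<and> w \<in> {v} \<and> (m u, m w) \<in> {k+1..2*k} \<times> {1}} =
      {{u, w} | u w. u \<in> V \<and> w = v \<and> {u, v} \<in> E}"
    using m1 by (intro doubleton_Collect_cong) auto
  then have "{{u, w} | u w. u \<in> V \<and> w \<in> {v} \<and> (m u, m w) \<in> {k+1..2*k} \<times> {1}} =
      {{u, v} | u. u \<in> V \<and> {u, v} \<in> E}" by simp
  ultimately show ?thesis
    using edges_insert_vertex[OF assms(1,2)] by auto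
qed

text \<open>Guarantees that the minimum defining the width is attained. Building the graph vertex by
  vertex doubles the bound each time, but only its existence matters.\<close>

lemma NLC_on_exists:
  "finite V \<Longrightarrow> finite_simple_graph (V, E) \<Longrightarrow> \<exists>k\<ge>1. \<exists>l. NLC_on k V E l"
proof (induction V arbitrary: E rule: finite_induct)
  case empty
  then have "E = {}" unfolding finite_simple_graph_def by auto
  then show ?case unfolding NLC_on_def by auto
next
  case (insert v V)
  obtain k l where k: "1 \<le> k" "NLC_on k V {e \<in> E. e \<subseteq> V} l"
    using insert.IH[OF finite_simple_graph_induced[OF insert.prems]] by auto
  then have "1 \<le> 2 * k" by auto
  then show ?case using NLC_on_insert_vertex[OF insert.prems insert.hyps(2) k] by blast
qed

section \<open>Clique-width\<close>

definition CW_on :: "nat \<Rightarrow> 'a set \<Rightarrow> 'a set set \<Rightarrow> ('a \<Rightarrow> nat) \<Rightarrow> bool" where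
  "CW_on k V E l \<longleftrightarrow> V = {} \<and> E = {} \<or> (\<exists>l'. (V, E, l') \<in> CW k \<and> (\<forall>v\<in>V. l' v = l v))"

lemma CW_wf:
  "(V, E, l) \<in> CW k \<Longrightarrow> V \<noteq> {} \<and> finite V \<and> {} \<notin> E \<and> (\<forall>e\<in>E. e \<subseteq> V) \<and> l ` V \<subseteq> {1..k}"
proof (induction V E l rule: CW.induct)
  case (union V\<^sub>1 E\<^sub>1 l\<^sub>1 V\<^sub>2 E\<^sub>2 l\<^sub>2)
  have "(\<lambda>v. if v \<in> V\<^sub>1 then l\<^sub>1 v else l\<^sub>2 v) ` (V\<^sub>1 \<union> V\<^sub>2) \<subseteq> {1..k}"
    using union.IH by (auto simp: image_subset_iff)
  then show ?case using union.IH by blast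
next
  case (join V E l a b)
  then show ?case by blast
qed (simp_all add: image_subset_iff)

text \<open>Edges come only from joins, and a join requires two distinct labels.\<close>

lemma CW_1_no_edges: "(V, E, l) \<in> CW k \<Longrightarrow> k = 1 \<Longrightarrow> E = {}"
  by (induction V E l rule: CW.induct) auto

lemma CW_on_cong:
  "CW_on k V E l \<Longrightarrow> (\<And>v. v \<in> V \<Longrightarrow> l v = l' v) \<Longrightarrow> CW_on k V E l'"
  unfolding CW_on_def by metis

lemma CW_onI: "(V, E, l) \<in> CW k \<Longrightarrow> (\<And>v. v \<in> V \<Longrightarrow> l v = l' v) \<Longrightarrow> CW_on k V E l'"
  unfolding CW_on_def by blast

lemma CW_onE:
  assumes "CW_on k V E l" "V \<noteq> {} \<or> E \<noteq> {}"
  obtains l' where "(V, E, l') \<in> CW k" "\<forall>v\<in>V. l' v = l v"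
  using assms unfolding CW_on_def by blast

lemma CW_on_empty: "CW_on k {} {} l"
  unfolding CW_on_def by blast

lemma CW_on_single: "l v \<in> {1..k} \<Longrightarrow> CW_on k {v} {} l"
  by (rule CW_onI[OF CW.single]) auto

lemma CW_on_union:
  assumes "CW_on k V\<^sub>1 E\<^sub>1 l" "CW_on k V\<^sub>2 E\<^sub>2 l" "V\<^sub>1 \<inter> V\<^sub>2 = {}"
  shows "CW_on k (V\<^sub>1 \<union> V\<^sub>2) (E\<^sub>1 \<union> E\<^sub>2) l"
proof (cases "V\<^sub>1 = {} \<and> E\<^sub>1 = {} \<or> V\<^sub>2 = {} \<and> E\<^sub>2 = {}")
  case True
  then show ?thesis using assms(1,2) by auto
next
  case False
  then have "V\<^sub>1 \<noteq> {} \<or> E\<^sub>1 \<noteq> {}" "V\<^sub>2 \<noteq> {} \<or> E\<^sub>2 \<noteq> {}" by simp_all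
  with assms(1,2) obtain l\<^sub>1 l\<^sub>2 where
    l: "(V\<^sub>1, E\<^sub>1, l\<^sub>1) \<in> CW k" "\<forall>v\<in>V\<^sub>1. l\<^sub>1 v = l v"
      "(V\<^sub>2, E\<^sub>2, l\<^sub>2) \<in> CW k" "\<forall>v\<in>V\<^sub>2. l\<^sub>2 v = l v"
    by (elim CW_onE) blast
  show ?thesis
    by (rule CW_onI[OF CW.union[OF l(1,3) assms(3)]]) (use l(2,4) in auto)
qed

lemma CW_on_relabel:
  assumes "CW_on k V E l" "a \<in> {1..k}" "b \<in> {1..k}" "a \<noteq> b"
  shows "CW_on k V E (\<lambda>v. if l v = a then b else l v)"
proof (cases "V = {} \<and> E = {}")
  case False
  then have "V \<noteq> {} \<or> E \<noteq> {}" by simp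
  with assms(1) obtain m where m: "(V, E, m) \<in> CW k" "\<forall>v\<in>V. m v = l v"
    by (rule CW_onE)
  show ?thesis
    by (rule CW_onI[OF CW.relabel[OF m(1) assms(2-4)]]) (use m(2) in simp)
qed (use CW_on_empty in blast)

lemma CW_on_join:
  assumes "CW_on k V E l" "a \<in> {1..k}" "b \<in> {1..k}" "a \<noteq> b"
  shows "CW_on k V (E \<union> {{u, v} | u v. u \<in> V \<and> v \<in> V \<and> l u = a \<and> l v = b}) l"
proof (cases "V = {} \<and> E = {}")
  case False
  then have "V \<noteq> {} \<or> E \<noteq> {}" by simp
  with assms(1) obtain l' where l': "(V, E, l') \<in> CW k" "\<forall>v\<in>V. l' v = l v"
    by (rule CW_onE)
  then have "{{u, v} | u v. u \<in> V \<and> v \<in> V \<and> l u = a \<and> l v = b} =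
      {{u, v} | u v. u \<in> V \<and> v \<in> V \<and> l' u = a \<and> l' v = b}"
    by (intro doubleton_Collect_cong) auto
  with CW.join[OF l'(1) assms(2-4)]
  have "(V, E \<union> {{u, v} | u v. u \<in> V \<and> v \<in> V \<and> l u = a \<and> l v = b}, l') \<in> CW k" by simp
  then show ?thesis by (rule CW_onI) (use l'(2) in auto)
qed (simp add: CW_on_def)

text \<open>A clique-width relabeling moves one label at a time, so the labels of \<open>A\<close>
  are sent to \<open>b\<close> one after another. If \<open>b\<close> itself lies in
  \<open>A\<close>, its turn changes nothing; this case is separate because a relabeling must have
  distinct labels.\<close>

lemma CW_on_merge:
  assumes "finite A" "A \<subseteq> {1..k}" "b \<in> {1..k}" "CW_on k V E l"
  shows "CW_on k V E (\<lambda>v. if l v \<in> A then b else l v)"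
  using assms
proof (induction A rule: finite_induct)
  case (insert a A)
  let ?m = "\<lambda>v. if l v \<in> A then b else l v"
  have IH: "CW_on k V E ?m" using insert by auto
  show ?case
  proof (cases "a = b")
    case True
    then show ?thesis by (auto intro: CW_on_cong[OF IH])
  next
    case False
    have "CW_on k V E (\<lambda>v. if ?m v = a then b else ?m v)"
      by (rule CW_on_relabel[OF IH]) (use insert.prems False in auto)
    then show ?thesis by (rule CW_on_cong) (use False in auto)
  qed
qed auto

lemma CW_on_no_edges: "finite V \<Longrightarrow> a \<in> {1..k} \<Longrightarrow> CW_on k V {} (\<lambda>_. a)"
proof (induction V rule: finite_induct)
  case (insert v V)
  have "CW_on k ({v} \<union> V) ({} \<union> {}) (\<lambda>_. a)"
    by (rule CW_on_union) (use insert in \<open>auto intro: CW_on_single\<close>)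
  then show ?case by simp
qed (simp add: CW_on_def)

section \<open>Induced subgraphs and injective renaming for clique-width\<close>

text \<open>As for NLC-width, restriction and renaming commute with every operation. A join
  restricted to \<open>U\<close> is the join of the restricted graph, since the edges it adds depend
  only on the labels of their ends.\<close>

lemma CW_embed:
  "(V, E, l) \<in> CW k \<Longrightarrow> U \<subseteq> V \<Longrightarrow> inj_on f U \<Longrightarrow> (\<And>v. v \<in> U \<Longrightarrow> l' (f v) = l v) \<Longrightarrow>
   CW_on k (f ` U) ((`) f ` {e \<in> E. e \<subseteq> U}) l'"
proof (induction V E l arbitrary: U l' rule: CW.induct)
  case (single a v)
  then have "U = {} \<or> U = {v}" by auto
  then show ?case
  proof
    assume "U = {v}"
    then show ?thesis using single CW_on_single[of l' "f v" k] by auto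
  qed (simp add: CW_on_def)
next
  case (union V\<^sub>1 E\<^sub>1 l\<^sub>1 V\<^sub>2 E\<^sub>2 l\<^sub>2)
  let ?U\<^sub>1 = "U \<inter> V\<^sub>1" and ?U\<^sub>2 = "U \<inter> V\<^sub>2"
  have lab: "l' (f v) = l\<^sub>1 v" if "v \<in> ?U\<^sub>1" for v using union.prems(3)[of v] that by auto
  have lab': "l' (f v) = l\<^sub>2 v" if "v \<in> ?U\<^sub>2" for v
    using union.prems(3)[of v] union.hyps(3) that by auto
  have "CW_on k (f ` ?U\<^sub>1) ((`) f ` {e \<in> E\<^sub>1. e \<subseteq> ?U\<^sub>1}) l'"
    using union.IH(1)[of ?U\<^sub>1 l'] lab inj_on_subset[OF union.prems(2)] by auto
  moreover have "CW_on k (f ` ?U\<^sub>2) ((`) f ` {e \<in> E\<^sub>2. e \<subseteq> ?U\<^sub>2}) l'"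
    using union.IH(2)[of ?U\<^sub>2 l'] lab' inj_on_subset[OF union.prems(2)] by auto
  moreover have "f ` ?U\<^sub>1 \<inter> f ` ?U\<^sub>2 = {}"
    using union.hyps(3) union.prems(2) by (auto dest: inj_onD)
  ultimately have *: "CW_on k (f ` ?U\<^sub>1 \<union> f ` ?U\<^sub>2)
    ((`) f ` {e \<in> E\<^sub>1. e \<subseteq> ?U\<^sub>1} \<union> (`) f ` {e \<in> E\<^sub>2. e \<subseteq> ?U\<^sub>2}) l'"
    by (rule CW_on_union)
  have "{e \<in> E\<^sub>1. e \<subseteq> ?U\<^sub>1} = {e \<in> E\<^sub>1. e \<subseteq> U}" "{e \<in> E\<^sub>2. e \<subseteq> ?U\<^sub>2} = {e \<in> E\<^sub>2. e \<subseteq> U}"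
    using CW_wf[OF union.hyps(1)] CW_wf[OF union.hyps(2)] by auto
  moreover have "{e \<in> E\<^sub>1 \<union> E\<^sub>2. e \<subseteq> U} = {e \<in> E\<^sub>1. e \<subseteq> U} \<union> {e \<in> E\<^sub>2. e \<subseteq> U}" by blast
  moreover have "f ` U = f ` ?U\<^sub>1 \<union> f ` ?U\<^sub>2" using union.prems(1) by auto
  ultimately show ?case using * by (simp only: image_Un)
next
  case (relabel V E l a b)
  have "CW_on k (f ` U) ((`) f ` {e \<in> E. e \<subseteq> U}) (l \<circ> inv_into U f)"
    using relabel.prems by (intro relabel.IH) auto
  from CW_on_relabel[OF this relabel.hyps(2-4)] show ?case
    by (rule CW_on_cong) (use relabel.prems in auto)
next
  case (join V E l a b)
  let ?X = "{{u, v} | u v. u \<in> V \<and> v \<in> V \<and> l u = a \<and> l v = b}"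
  have "CW_on k (f ` U) ((`) f ` {e \<in> E. e \<subseteq> U}) l'"
    using join.prems by (intro join.IH) auto
  from CW_on_join[OF this join.hyps(2-4)]
  have *: "CW_on k (f ` U) ((`) f ` {e \<in> E. e \<subseteq> U} \<union>
      {{u, v} | u v. u \<in> f ` U \<and> v \<in> f ` U \<and> l' u = a \<and> l' v = b}) l'" .
  have "{{u, v} | u v. u \<in> f ` U \<and> v \<in> f ` U \<and> l' u = a \<and> l' v = b} =
      (`) f ` {{u, v} | u v. u \<in> U \<and> v \<in> U \<and> l u = a \<and> l v = b}"
    unfolding doubleton_Collect_image
    by (intro arg_cong[where f = "(`) ((`) f)"] doubleton_Collect_cong)
       (use join.prems(3) in auto)
  also have "{{u, v} | u v. u \<in> U \<and> v \<in> U \<and> l u = a \<and> l v = b} = {e \<in> ?X. e \<subseteq> U}"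
    using join.prems(1) by auto
  finally have X: "{{u, v} | u v. u \<in> f ` U \<and> v \<in> f ` U \<and> l' u = a \<and> l' v = b} =
    (`) f ` {e \<in> ?X. e \<subseteq> U}" .
  have "{e \<in> E \<union> ?X. e \<subseteq> U} = {e \<in> E. e \<subseteq> U} \<union> {e \<in> ?X. e \<subseteq> U}" by blast
  then show ?case using * unfolding X by (simp only: image_Un)
qed

lemma CW_on_embed:
  assumes "CW_on k V E l" "U \<subseteq> V" "inj_on f U"
  shows "\<exists>l'. CW_on k (f ` U) ((`) f ` {e \<in> E. e \<subseteq> U}) l'"
proof (cases "V = {} \<and> E = {}")
  case False
  then obtain l' where "(V, E, l') \<in> CW k" using assms(1) unfolding CW_on_def by auto
  from CW_embed[OF this assms(2,3), of "l' \<circ> inv_into U f"] assms(3) show ?thesis by auto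
qed (use assms in \<open>auto simp: CW_on_def\<close>)

section \<open>Adding one vertex for clique-width\<close>

text \<open>The two copies of each label are again treated alike, but clique-width operations
  address single labels. One relabeling becomes two, and one join becomes four, one for each choice
  of copies of \<open>a\<close> and \<open>b\<close>.\<close>

lemma CW_split_labels:
  "(V, E, l) \<in> CW k \<Longrightarrow> CW_on (2 * k) V E (\<lambda>v. if v \<in> N then l v + k else l v)"
proof (induction V E l rule: CW.induct)
  case (single a v)
  then show ?case by (intro CW_on_single) auto
next
  case (union V\<^sub>1 E\<^sub>1 l\<^sub>1 V\<^sub>2 E\<^sub>2 l\<^sub>2)
  show ?case
    by (rule CW_on_union[OF CW_on_cong[OF union.IH(1)] CW_on_cong[OF union.IH(2)]])
       (use union.hyps(3) in auto)
next
  case (relabel V E l a b)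
  have "l v \<in> {1..k}" if "v \<in> V" for v using CW_wf[OF relabel.hyps(1)] that by auto
  \<comment> \<open>The nested conditional is the relabeling of \<open>a\<close> to \<open>b\<close>
    followed by that of \<open>a + k\<close> to \<open>b + k\<close>. They do not interfere, since
    \<open>b \<le> k < a + k\<close>.\<close>
  moreover have "CW_on (2 * k) V E (\<lambda>v. if (if (if v \<in> N then l v + k else l v) = a then b
      else (if v \<in> N then l v + k else l v)) = a + k then b + k
      else (if (if v \<in> N then l v + k else l v) = a then b
      else (if v \<in> N then l v + k else l v)))"
    by (intro CW_on_relabel relabel.IH) (use relabel.hyps in auto)
  ultimately show ?case
    by (elim CW_on_cong) (use relabel.hyps in fastforce)
next
  case (join V E l a b)
  define m where "m = (\<lambda>v. if v \<in> N then l v + k else l v)"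
  let ?J = "\<lambda>c d. {{u, v} | u v. u \<in> V \<and> v \<in> V \<and> m u = c \<and> m v = d}"
  let ?X = "{{u, v} | u v. u \<in> V \<and> v \<in> V \<and> l u = a \<and> l v = b}"
  have m: "l u = c \<longleftrightarrow> m u = c \<or> m u = c + k" if "u \<in> V" "c \<in> {1..k}" for u c
  proof -
    have "l u \<in> {1..k}" using CW_wf[OF join.hyps(1)] that(1) by auto
    then show ?thesis using that(2) by (auto simp: m_def)
  qed
  have "CW_on (2 * k) V E m" unfolding m_def by (rule join.IH)
  then have *: "CW_on (2 * k) V (E \<union> ?J a b \<union> ?J a (b + k) \<union> ?J (a + k) b \<union> ?J (a + k) (b + k)) m"
    by (intro CW_on_join) (use join.hyps in auto)
  have "?X = {{u, v} | u v. u \<in> V \<and> v \<in> V \<and>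
      (m u = a \<or> m u = a + k) \<and> (m v = b \<or> m v = b + k)}"
    using m[OF _ join.hyps(2)] m[OF _ join.hyps(3)] by (intro doubleton_Collect_cong) blast
  also have "\<dots> = ?J a b \<union> ?J a (b + k) \<union> ?J (a + k) b \<union> ?J (a + k) (b + k)"
    by blast
  finally have "E \<union> ?X = E \<union> ?J a b \<union> ?J a (b + k) \<union> ?J (a + k) b \<union> ?J (a + k) (b + k)"
    by (simp only: Un_assoc)
  with * have "CW_on (2 * k) V (E \<union> ?X) m" by (simp only:)
  then show ?case unfolding m_def .
qed

text \<open>This settles the addition of a vertex at width 1. The star on \<open>N\<close> and
  \<open>v\<close> is completed first with labels 1 and 2, and the isolated vertices of
  \<open>V - N\<close> join only afterwards, so they receive no edges.\<close>

lemma CW_on_star: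
  assumes "finite V" "N \<subseteq> V" "v \<notin> V"
  shows "\<exists>l. CW_on 2 (insert v V) {{u, v} | u. u \<in> N} l"
proof -
  define m :: "'a \<Rightarrow> nat" where "m = (\<lambda>u. if u = v then 2 else 1)"
  have "finite N" using assms finite_subset by auto
  then have "CW_on 2 N {} m"
    using assms by (intro CW_on_cong[OF CW_on_no_edges[of N 1]]) (auto simp: m_def)
  moreover have "CW_on 2 {v} {} m" by (rule CW_on_single) (auto simp: m_def)
  ultimately have "CW_on 2 (N \<union> {v}) ({} \<union> {}) m"
    by (rule CW_on_union) (use assms in auto)
  then have "CW_on 2 (N \<union> {v})
      ({} \<union> {} \<union> {{u, w} | u w. u \<in> N \<union> {v} \<and> w \<in> N \<union> {v} \<and> m u = 1 \<and> m w = 2}) m"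
    by (rule CW_on_join) auto
  moreover have "{{u, w} | u w. u \<in> N \<union> {v} \<and> w \<in> N \<union> {v} \<and> m u = 1 \<and> m w = 2} =
      {{u, v} | u. u \<in> N}"
    using assms by (auto simp: m_def)
  ultimately have "CW_on 2 (N \<union> {v}) {{u, v} | u. u \<in> N} m" by simp
  \<comment> \<open>Once the star is built its labels are made constant, so that one labeling serves
    both sides of the last union.\<close>
  then have "CW_on 2 (N \<union> {v}) {{u, v} | u. u \<in> N} (\<lambda>w. if m w = 2 then 1 else m w)"
    by (rule CW_on_relabel) auto
  then have "CW_on 2 (N \<union> {v}) {{u, v} | u. u \<in> N} (\<lambda>_. 1)"
    by (rule CW_on_cong) (auto simp: m_def)
  moreover have "CW_on 2 (V - N) {} (\<lambda>_. 1)"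
    by (rule CW_on_no_edges) (use assms in auto)
  ultimately have "CW_on 2 ((N \<union> {v}) \<union> (V - N)) ({{u, v} | u. u \<in> N} \<union> {}) (\<lambda>_. 1)"
    by (rule CW_on_union) (use assms in auto)
  moreover have "(N \<union> {v}) \<union> (V - N) = insert v V" using assms by auto
  ultimately show ?thesis by auto
qed

text \<open>A clique-width join acts on the whole graph, so \<open>v\<close> needs a label that no
  other vertex carries. Once the edges inside \<open>V\<close> are present, only adjacency to
  \<open>v\<close> has to be remembered, and two labels suffice for that.\<close>

lemma CW_on_insert_vertex:
  assumes "finite_simple_graph (insert v V, E)" "v \<notin> V" "1 \<le> k" "CW_on k V {e \<in> E. e \<subseteq> V} l"
  shows "\<exists>l. CW_on (2 * k) (insert v V) E l"
proof (cases "V = {}")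
  case True
  then have "E = {}" using assms(1) unfolding finite_simple_graph_def by auto
  then show ?thesis using True CW_on_single[of "\<lambda>_. 1" v "2 * k"] assms(3) by auto
next
  case False
  define N where "N = {u \<in> V. {u, v} \<in> E}"
  have E: "E = {e \<in> E. e \<subseteq> V} \<union> {{u, v} | u. u \<in> N}"
    using edges_insert_vertex[OF assms(1,2)] unfolding N_def by simp
  obtain l' where l': "(V, {e \<in> E. e \<subseteq> V}, l') \<in> CW k"
    using assms(4) False unfolding CW_on_def by auto
  show ?thesis
  proof (cases "k = 1")
    case True
    then have "{e \<in> E. e \<subseteq> V} = {}" using CW_1_no_edges[OF l'] by simp
    then have "E = {{u, v} | u. u \<in> N}" using E by blast
    moreover have "finite V" using CW_wf[OF l'] by simp
    ultimately show ?thesis using CW_on_star[of V N v] assms(2) True by (auto simp: N_def)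
  next
    case k: False
    define m where "m = (\<lambda>u. if u \<in> N then l' u + k else l' u)"
    \<comment> \<open>Merging the lower copy to 1 and the upper one to \<open>k + 1\<close> frees
      label 2 for \<open>v\<close>. This works because \<open>k \<ge> 2\<close>; for
      \<open>k = 1\<close> the labels 2 and \<open>k + 1\<close> would coincide.\<close>
    define n where "n = (\<lambda>u. if u = v then 2 else if u \<in> N then k + 1 else 1)"
    have l: "l' u \<in> {1..k}" if "u \<in> V" for u using CW_wf[OF l'] that by auto
    have "CW_on (2*k) V {e \<in> E. e \<subseteq> V} m"
      unfolding m_def by (rule CW_split_labels[OF l'])
    then have "CW_on (2*k) V {e \<in> E. e \<subseteq> V} (\<lambda>u. if m u \<in> {1..k} then 1 else m u)"
      by (rule CW_on_merge[rotated -1]) (use assms(3) in auto)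
    \<comment> \<open>The second merge acts on the result of the first and leaves label 1 fixed, as
      1 lies below \<open>k + 1\<close>.\<close>
    then have "CW_on (2*k) V {e \<in> E. e \<subseteq> V}
       (\<lambda>u. if (if m u \<in> {1..k} then 1 else m u) \<in> {k+1..2*k} then k + 1
            else (if m u \<in> {1..k} then 1 else m u))"
      by (rule CW_on_merge[rotated -1]) (use assms(3) in auto)
    then have "CW_on (2*k) V {e \<in> E. e \<subseteq> V} n"
      by (rule CW_on_cong) (use l assms(2) in \<open>fastforce simp: m_def n_def\<close>)
    moreover have "CW_on (2*k) {v} {} n"
      by (rule CW_on_single) (use assms(3) in \<open>auto simp: n_def\<close>)
    ultimately have "CW_on (2*k) (V \<union> {v}) ({e \<in> E. e \<subseteq> V} \<union> {}) n"
      by (rule CW_on_union) (use assms(2) in auto)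
    then have "CW_on (2*k) (V \<union> {v}) ({e \<in> E. e \<subseteq> V} \<union> {} \<union>
        {{u, w} | u w. u \<in> V \<union> {v} \<and> w \<in> V \<union> {v} \<and> n u = k + 1 \<and> n w = 2}) n"
      by (rule CW_on_join) (use assms(3) k in auto)
    moreover have "n u = k + 1 \<longleftrightarrow> u \<in> N" "n u = 2 \<longleftrightarrow> u = v" for u
      using assms(2,3) k by (auto simp: n_def N_def)
    then have "{{u, w} | u w. u \<in> V \<union> {v} \<and> w \<in> V \<union> {v} \<and> n u = k + 1 \<and> n w = 2} =
        {{u, v} | u. u \<in> N}" by (auto simp: N_def)
    ultimately show ?thesis using E by auto
  qed
qed

lemma CW_on_exists:
  "finite V \<Longrightarrow> finite_simple_graph (V, E) \<Longrightarrow> \<exists>k\<ge>1. \<exists>l. CW_on k V E l"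
proof (induction V arbitrary: E rule: finite_induct)
  case empty
  then have "E = {}" unfolding finite_simple_graph_def by auto
  then show ?case unfolding CW_on_def by auto
next
  case (insert v V)
  obtain k l where k: "1 \<le> k" "CW_on k V {e \<in> E. e \<subseteq> V} l"
    using insert.IH[OF finite_simple_graph_induced[OF insert.prems]] by auto
  then have "1 \<le> 2 * k" by auto
  then show ?case using CW_on_insert_vertex[OF insert.prems insert.hyps(2) k] by blast
qed

section \<open>Vertex identification\<close>

lemma finite_simple_graph_identify:
  assumes "finite_simple_graph (V, E)"
  shows "finite_simple_graph (identify (V, E) x y)"
  unfolding identify_def fst_conv snd_conv
proof (rule finite_simple_graphI)
  show "finite (insert None (Some ` (V - {x, y})))"
    using assms by (simp add: finite_simple_graph_def)
  \<comment> \<open>The edges at \<open>None\<close> are described by adjacency to \<open>x\<close>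
    or \<open>y\<close> alone; that their other end is a vertex follows from the edges of the
    original graph lying inside \<open>V\<close>.\<close>
  have edge: "u \<in> V" if uv: "{u, v} \<in> E" for u v
    using assms uv by (rule finite_simple_graph_edge) (metis insertCI insertE singletonD)
  fix e assume "e \<in> {Some ` e | e. e \<in> E \<and> x \<notin> e \<and> y \<notin> e} \<union>
      {{Some u, None} | u. u \<notin> {x, y} \<and> ({u, x} \<in> E \<or> {u, y} \<in> E)}"
  then consider d where "d \<in> E" "x \<notin> d" "y \<notin> d" "e = Some ` d"
    | u where "e = {Some u, None}" "u \<notin> {x, y}" "{u, x} \<in> E \<or> {u, y} \<in> E"
    by blast
  then show "\<exists>a b. e = {a, b} \<and> a \<in> insert None (Some ` (V - {x, y})) \<and>
      b \<in> insert None (Some ` (V - {x, y})) \<and> a \<noteq> b"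
  proof cases
    case 1
    from assms 1(1) obtain a b where "d = {a, b}" "a \<in> V" "b \<in> V" "a \<noteq> b"
      by (rule finite_simple_graph_edge)
    with 1 show ?thesis by (intro exI[of _ "Some a"] exI[of _ "Some b"]) auto
  next
    case 2
    then show ?thesis using edge by (intro exI[of _ "Some u"] exI[of _ None]) auto
  qed
qed

text \<open>Away from \<open>x\<close> and \<open>y\<close> identification changes nothing but the
  names. Edges at \<open>None\<close> drop out on the left, and an edge of the original graph avoids
  \<open>x\<close> and \<open>y\<close> exactly when it lies in the remaining vertex set.\<close>

lemma identify_induced:
  assumes "finite_simple_graph G"
  shows "{e \<in> snd (identify G x y). e \<subseteq> Some ` (fst G - {x, y})} =
    (`) Some ` {e \<in> snd G. e \<subseteq> fst G - {x, y}}"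
proof -
  have "e \<subseteq> fst G" if "e \<in> snd G" for e
    using assms that finite_simple_graph_edge[of "fst G" "snd G" e] by auto
  then have "x \<notin> e \<and> y \<notin> e \<longleftrightarrow> e \<subseteq> fst G - {x, y}" if "e \<in> snd G" for e
    using that by blast
  then show ?thesis
    unfolding identify_def by (auto simp: image_iff)
qed

lemma induced_induced: "U \<subseteq> W \<Longrightarrow> {e \<in> {e \<in> E. e \<subseteq> W}. e \<subseteq> U} = {e \<in> E. e \<subseteq> U}"
  by blast

section \<open>Comparison of the minimal widths\<close>

lemma LEAST_le_mult:
  fixes P Q :: "nat \<Rightarrow> bool"
  assumes "\<exists>k. P k" "\<And>k. P k \<Longrightarrow> Q (c * k)"
  shows "(LEAST k. Q k) \<le> c * (LEAST k. P k)"
  using assms by (meson LeastI_ex Least_le)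

text \<open>The same width is represented twice, by \<open>P\<close> over the original vertices and by \<open>Q\<close> over their
  option type, since an assumed predicate cannot be polymorphic.\<close>

lemma identify_width_bounds:
  fixes P :: "nat \<Rightarrow> 'a set \<Rightarrow> 'a set set \<Rightarrow> bool"
    and Q :: "nat \<Rightarrow> 'a option set \<Rightarrow> 'a option set set \<Rightarrow> bool"
  assumes G: "finite_simple_graph G" "x \<in> fst G" "y \<in> fst G" "x \<noteq> y"
    and PQ: "\<And>k V E U. P k V E \<Longrightarrow> U \<subseteq> V \<Longrightarrow> Q k (Some ` U) ((`) Some ` {e \<in> E. e \<subseteq> U})"
    and QP: "\<And>k V E U. Q k V E \<Longrightarrow> U \<subseteq> V \<Longrightarrow> None \<notin> U \<Longrightarrow>
      P k (the ` U) ((`) the ` {e \<in> E. e \<subseteq> U})"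
    and P_insert: "\<And>k v V E. finite_simple_graph (insert v V, E) \<Longrightarrow> v \<notin> V \<Longrightarrow> 1 \<le> k \<Longrightarrow>
      P k V {e \<in> E. e \<subseteq> V} \<Longrightarrow> P (2 * k) (insert v V) E"
    and Q_insert: "\<And>k v V E. finite_simple_graph (insert v V, E) \<Longrightarrow> v \<notin> V \<Longrightarrow> 1 \<le> k \<Longrightarrow>
      Q k V {e \<in> E. e \<subseteq> V} \<Longrightarrow> Q (2 * k) (insert v V) E"
    and P_ex: "\<And>V E. finite V \<Longrightarrow> finite_simple_graph (V, E) \<Longrightarrow> \<exists>k\<ge>1. P k V E"
  defines "H \<equiv> identify G x y"
  shows "(LEAST k. 1 \<le> k \<and> P k (fst G) (snd G)) \<le>
           4 * (LEAST k. 1 \<le> k \<and> Q k (fst H) (snd H)) \<and>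
         (LEAST k. 1 \<le> k \<and> Q k (fst H) (snd H)) \<le>
           2 * (LEAST k. 1 \<le> k \<and> P k (fst G) (snd G))"
proof -
  let ?K = "fst G - {x, y}"
  have H: "fst H = insert None (Some ` ?K)" by (simp add: H_def identify_def)
  have fG: "fst G = insert y (insert x ?K)" using G by auto
  have sG: "finite_simple_graph (insert y (insert x ?K), snd G)"
    using G(1) by (simp only: fG[symmetric] prod.collapse)
  have sH: "finite_simple_graph (insert None (Some ` ?K), snd H)"
    using finite_simple_graph_identify[of "fst G" "snd G" x y] G(1) H
    unfolding H_def by (metis prod.collapse)
  have induced: "{e \<in> snd H. e \<subseteq> Some ` ?K} = (`) Some ` {e \<in> snd G. e \<subseteq> ?K}"
    unfolding H_def by (rule identify_induced[OF G(1)])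
  \<comment> \<open>Deleting \<open>x\<close> and \<open>y\<close> does not raise the width, and
    adding \<open>None\<close> doubles it once.\<close>
  have GH: "Q (2 * k) (fst H) (snd H)" if "1 \<le> k" "P k (fst G) (snd G)" for k
    unfolding H using PQ[OF that(2), of ?K] that(1) induced by (intro Q_insert[OF sH]) auto
  \<comment> \<open>Deleting \<open>None\<close> and renaming by \<open>the\<close> recovers the
    common subgraph. Adding \<open>x\<close> and then \<open>y\<close> doubles twice, whence the
    factor 4.\<close>
  have HG: "P (4 * k) (fst G) (snd G)" if k: "1 \<le> k" "Q k (fst H) (snd H)" for k
  proof -
    have "P k (the ` Some ` ?K) ((`) the ` (`) Some ` {e \<in> snd G. e \<subseteq> ?K})"
      using QP[OF k(2), of "Some ` ?K"] unfolding H induced by auto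
    then have K: "P k ?K {e \<in> snd G. e \<subseteq> ?K}" by (simp add: image_image)
    have "P (2 * k) (insert x ?K) {e \<in> snd G. e \<subseteq> insert x ?K}"
    proof (rule P_insert)
      show "finite_simple_graph (insert x ?K, {e \<in> snd G. e \<subseteq> insert x ?K})"
        by (rule finite_simple_graph_induced[OF sG]) auto
      show "P k ?K {e \<in> {e \<in> snd G. e \<subseteq> insert x ?K}. e \<subseteq> ?K}"
        using K by (subst induced_induced) auto
    qed (use k in auto)
    then have "P (2 * (2 * k)) (insert y (insert x ?K)) (snd G)"
      using G k by (intro P_insert[OF sG]) auto
    then show ?thesis using fG by simp
  qed
  have "finite (fst G)" using G(1) by (simp add: finite_simple_graph_def)
  then obtain k where k: "1 \<le> k" "P k (fst G) (snd G)"
    using P_ex[of "fst G" "snd G"] G(1) by auto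
  have exP: "\<exists>k. 1 \<le> k \<and> P k (fst G) (snd G)" using k by blast
  have exQ: "\<exists>k. 1 \<le> k \<and> Q k (fst H) (snd H)"
    using GH[OF k] k(1) by (intro exI[of _ "2 * k"]) auto
  show ?thesis
    by (intro conjI LEAST_le_mult exP exQ) (use GH HG in auto)
qed

text \<open>Nonemptiness excludes the extra disjunct of \<open>NLC_on\<close>, and with the labeling
  existentially quantified, agreement on the vertex set is no restriction.\<close>

lemma nlcw_eq:
  "fst G \<noteq> {} \<Longrightarrow> nlcw G = (LEAST k. 1 \<le> k \<and> (\<exists>l. NLC_on k (fst G) (snd G) l))"
  unfolding nlcw_def NLC_on_def by (intro arg_cong[where f = Least]) auto

lemma cw_eq:
  "fst G \<noteq> {} \<Longrightarrow> cw G = (LEAST k. 1 \<le> k \<and> (\<exists>l. CW_on k (fst G) (snd G) l))"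
  unfolding cw_def CW_on_def by (intro arg_cong[where f = Least]) auto

theorem theorem10:
  fixes G :: "'a graph" and x y :: 'a
  assumes "finite_simple_graph G"
    and "x \<in> fst G" and "y \<in> fst G" and "x \<noteq> y"
  shows "(1 / 4) * real (nlcw G) \<le> real (nlcw (identify G x y)) \<and>
         real (nlcw (identify G x y)) \<le> 2 * real (nlcw G) \<and>
         (1 / 4) * real (cw G) \<le> real (cw (identify G x y)) \<and>
         real (cw (identify G x y)) \<le> 2 * real (cw G)"
proof -
  have ne: "fst G \<noteq> {}" "fst (identify G x y) \<noteq> {}"
    using assms by (auto simp: identify_def)
  \<comment> \<open>This makes \<open>the\<close> an admissible renaming in the embedding lemmas
    once the identified vertex is removed.\<close>
  have the: "inj_on the U" if "None \<notin> U" for U :: "'a option set"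
    using that by (intro inj_onI) (metis option.expand)
  have "nlcw G \<le> 4 * nlcw (identify G x y) \<and> nlcw (identify G x y) \<le> 2 * nlcw G"
    unfolding nlcw_eq[OF ne(1)] nlcw_eq[OF ne(2)]
    by (rule identify_width_bounds[OF assms, where P = "\<lambda>k V E. \<exists>l. NLC_on k V E l"
          and Q = "\<lambda>k V E. \<exists>l. NLC_on k V E l"])
       (blast intro: NLC_on_embed[OF _ _ inj_Some] NLC_on_embed[OF _ _ the]
          NLC_on_insert_vertex NLC_on_exists)+
  moreover have "cw G \<le> 4 * cw (identify G x y) \<and> cw (identify G x y) \<le> 2 * cw G"
    unfolding cw_eq[OF ne(1)] cw_eq[OF ne(2)]
    by (rule identify_width_bounds[OF assms, where P = "\<lambda>k V E. \<exists>l. CW_on k V E l"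
          and Q = "\<lambda>k V E. \<exists>l. CW_on k V E l"])
       (blast intro: CW_on_embed[OF _ _ inj_Some] CW_on_embed[OF _ _ the]
          CW_on_insert_vertex CW_on_exists)+
  ultimately show ?thesis by linarith
qed

end
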